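(* Let $n>0$ and $y\in(0,1)$ be fixed, with $y=x^2/(n+x^2)$, $x>0$, and let $\zeta=\frac12\delta^2y$. Then, as $\delta\to+\infty$, $$F_n(x;\delta)=2P_n(x;\delta)+\frac{e^{-\frac12\delta^2}\sqrt{y}\,(1-y)^{\frac12n}}{2\pi}\,\frac{\Gamma\left(\frac12n+\frac12\right)}{\zeta^{\frac12n+\frac12}}\left(1+\mathcal O\left(\delta^{-2}\right)\right).$$
   Context: Notation. $\operatorname{erfc}(z)=\frac{2}{\sqrt\pi}\int_z^\infty e^{-t^2}dt$. $I_y(a,b)=\frac{1}{B(a,b)}\int_0^y t^{a-1}(1-t)^{b-1}dt$ is the normalized incomplete beta function, with $B(a,b)=\Gamma(a)\Gamma(b)/\Gamma(a+b)$. For $x\ge 0$, $\delta\in\mathbb R$, $n>0$ (not necessarily an integer), with $y=x^2/(n+x^2)$, the noncentral $t$-distribution is $$F_n(x;\delta)=\tfrac12\operatorname{erfc}\left(\delta/\sqrt2\right)+P_n(x;\delta)+Q_n(x;\delta),$$ $$P_n(x;\delta)=\tfrac12 e^{-\frac12\delta^2}\sum_{j=0}^\infty \frac{(\frac12\delta^2)^j}{j!}\, I_y\left(j+\tfrac12,\tfrac12 n\right),\qquad Q_n(x;\delta)=\tfrac12 e^{-\frac12\delta^2}\sum_{j=0}^\infty \frac{\delta}{\sqrt2}\frac{(\frac12\delta^2)^j}{\Gamma(j+\frac32)}\, I_y\left(j+1,\tfrac12 n\right).$$ *)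

theory Defs
  imports "HOL-Analysis.Analysis" "HOL-Library.Landau_Symbols"
begin

definition erfc :: "real \<Rightarrow> real" where
  "erfc z = 2 / sqrt pi * integral {z..} (\<lambda>t. exp (- t\<^sup>2))"

(* Intended for 0 \<le> y \<le> 1 and a, b > 0. The junk value 0 powr c = 0 at the endpoints
   affects the integrand only on a null set. *)
definition inc_beta :: "real \<Rightarrow> real \<Rightarrow> real \<Rightarrow> real" where
  "inc_beta y a b =
     1 / Beta a b * integral {0..y} (\<lambda>t. t powr (a - 1) * (1 - t) powr (b - 1))"

definition nct_y :: "real \<Rightarrow> real \<Rightarrow> real" where
  "nct_y n x = x\<^sup>2 / (n + x\<^sup>2)"

definition nct_P :: "real \<Rightarrow> real \<Rightarrow> real \<Rightarrow> real" where
  "nct_P n x \<delta> = 1/2 * exp (- (\<delta>\<^sup>2 / 2)) *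
     (\<Sum>j::nat. (\<delta>\<^sup>2 / 2) ^ j / fact j * inc_beta (nct_y n x) (real j + 1/2) (n / 2))"

definition nct_Q :: "real \<Rightarrow> real \<Rightarrow> real \<Rightarrow> real" where
  "nct_Q n x \<delta> = 1/2 * exp (- (\<delta>\<^sup>2 / 2)) *
     (\<Sum>j::nat. \<delta> / sqrt 2 * ((\<delta>\<^sup>2 / 2) ^ j / Gamma (real j + 3/2)) *
        inc_beta (nct_y n x) (real j + 1) (n / 2))"

(* The noncentral t-distribution function F_n(x; \<delta>), for n > 0 and x \<ge> 0. *)
definition nct_F :: "real \<Rightarrow> real \<Rightarrow> real \<Rightarrow> real" where
  "nct_F n x \<delta> = 1/2 * erfc (\<delta> / sqrt 2) + nct_P n x \<delta> + nct_Q n x \<delta>"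

end

theory Submission
  imports Defs
begin

text \<open>
  Write \<open>b = n / 2\<close> and \<open>w = \<delta> / sqrt 2\<close>. The series \<open>P\<close> and \<open>Q\<close> are the even and odd parts of a single
  alternating series in powers of \<open>- w\<close>, and \<open>erfc\<close> is the same series with every incomplete beta
  factor replaced by \<open>1\<close>. Hence \<open>F - 2 P\<close> is an alternating series whose coefficients contain the
  complementary factors \<open>1 - I\<^sub>y\<close>. By the duplication formula for \<open>Gamma\<close>, this series resums to
  an integral over \<open>{y..1}\<close> of \<open>t powr (-1/2) * (1 - t) powr (b - 1)\<close> times the positive function
  \<open>\<integral>\<^sub>0\<^sup>\<infinity> s powr (b - 1/2) * exp (- s - 2 * w * sqrt (s * t)) ds\<close>. The bounds
  \<open>1 - s \<le> exp (- s) \<le> 1\<close> enclose the inner integral between explicit \<open>Gamma\<close> integrals whose ratio is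
  \<open>1 + O(1 / w\<^sup>2)\<close>, uniformly for \<open>t \<ge> y\<close>, and the remaining integral over \<open>t\<close> is elementary.
\<close>

section \<open>Substitution on half-lines and integrals of Gamma type\<close>

text \<open>Nonnegativity upgrades integrability to absolute integrability, which the general
  transformation theorem asks for. Improper integrals over half-lines can then be substituted
  directly, without limits of truncations.\<close>

lemma has_integral_change_of_variables_nonneg:
  fixes f g g' :: "real \<Rightarrow> real"
  assumes S: "S \<in> sets lebesgue"
    and der: "\<And>x. x \<in> S \<Longrightarrow> (g has_field_derivative g' x) (at x within S)"
    and inj: "inj_on g S"
    and nonneg: "\<And>x. x \<in> S \<Longrightarrow> 0 \<le> f (g x)"
    and int: "((\<lambda>x. \<bar>g' x\<bar> * f (g x)) has_integral I) S"
  shows "(f has_integral I) (g ` S)"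
proof -
  have "(\<lambda>x. \<bar>g' x\<bar> * f (g x)) absolutely_integrable_on S"
    using int nonneg by (intro nonnegative_absolutely_integrable_1) auto
  then have "f absolutely_integrable_on (g ` S) \<and> integral (g ` S) f = I"
    using int has_absolute_integral_change_of_variables_1'[OF S der inj, of f I]
    by (auto simp: integral_unique)
  then show ?thesis
    using absolutely_integrable_on_def integrable_integral by blast
qed

lemma has_integral_greaterThan_iff_atLeast:
  fixes f :: "real \<Rightarrow> 'a::euclidean_space"
  shows "(f has_integral I) {c<..} \<longleftrightarrow> (f has_integral I) {c..}"
proof (rule has_integral_spike_set_eq)
  show "negligible {x \<in> {c<..} - {c..}. f x \<noteq> 0}"
    by (rule negligible_subset[of "{}"]) auto
  show "negligible {x \<in> {c..} - {c<..}. f x \<noteq> 0}"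
    by (rule negligible_subset[of "{c}"]) auto
qed

lemma Gamma_integral_open:
  fixes a :: real
  assumes "a > 0"
  shows "((\<lambda>s. s powr (a - 1) * exp (- s)) has_integral Gamma a) {0<..}"
  using Gamma_integral_real[OF assms]
  by (simp add: has_integral_greaterThan_iff_atLeast exp_minus field_simps)

text \<open>Under s = (v / (2w))^2 the exponential becomes exp(-v), and the power of s together with
  the Jacobian becomes v^(2a - 1); what remains is Euler's integral for
  \<open>Gamma (2 * a)\<close>.\<close>

lemma Gamma_integral_sqrt:
  fixes a w :: real
  assumes a: "a > 0" and w: "w > 0"
  shows "((\<lambda>s. s powr (a - 1) * exp (- (2 * w * sqrt s))) has_integral
           2 * Gamma (2 * a) / (2 * w) powr (2 * a)) {0<..}"
proof -
  let ?g = "\<lambda>v. (v / (2 * w))\<^sup>2"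
  let ?f = "\<lambda>s. s powr (a - 1) * exp (- (2 * w * sqrt s))"
  have img: "?g ` {0<..} = {0<..}"
  proof (intro equalityI subsetI)
    fix s :: real assume "s \<in> {0<..}"
    then have "s = ?g (2 * w * sqrt s)" "2 * w * sqrt s \<in> {0<..}"
      using w by auto
    then show "s \<in> ?g ` {0<..}" by blast
  qed (use w in auto)
  have "(?f has_integral 2 * Gamma (2 * a) / (2 * w) powr (2 * a)) (?g ` {0<..})"
  proof (rule has_integral_change_of_variables_nonneg[where g' = "\<lambda>v. 2 * v / (2 * w)\<^sup>2"])
    show "(?g has_field_derivative 2 * v / (2 * w)\<^sup>2) (at v within {0<..})" for v
      unfolding power_divide by (rule DERIV_cdivide) (auto intro!: derivative_eq_intros)
    show "inj_on ?g {0<..}"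
      using w by (auto intro!: inj_onI simp: power_divide)
    have "((\<lambda>v. 2 / (2 * w) powr (2 * a) * (v powr (2 * a - 1) * exp (- v))) has_integral
             2 / (2 * w) powr (2 * a) * Gamma (2 * a)) {0<..}"
      using a by (intro has_integral_mult_right Gamma_integral_open) simp
    moreover have "2 / (2 * w) powr (2 * a) * (v powr (2 * a - 1) * exp (- v))
        = \<bar>2 * v / (2 * w)\<^sup>2\<bar> * ?f (?g v)" if "v \<in> {0<..}" for v
    proof -
      define u where "u = v / (2 * w)"
      have u: "u > 0" "v = 2 * w * u" using w that by (auto simp: u_def)
      have "(u\<^sup>2) powr (a - 1) = u powr (2 * a - 2)"
        using u by (simp add: powr_powr algebra_simps flip: powr_numeral)
      also have "\<dots> * u = u powr (2 * a - 1)"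
        using u powr_add[of u "2 * a - 2" 1] by simp
      finally have *: "(u\<^sup>2) powr (a - 1) * u = u powr (2 * a - 1)" .
      have "\<bar>2 * v / (2 * w)\<^sup>2\<bar> * ?f (?g v) = 2 * u / (2 * w) * ((u\<^sup>2) powr (a - 1) * exp (- v))"
        using u w by (simp flip: u_def) (simp add: power2_eq_square)
      also have "\<dots> = 2 / (2 * w) * u powr (2 * a - 1) * exp (- v)"
        by (simp add: * [symmetric])
      also have "\<dots> = 2 / (2 * w) powr (2 * a) * (v powr (2 * a - 1) * exp (- v))"
        using u w powr_add[of "2 * w" "2 * a - 1" 1] by (simp add: powr_mult field_simps)
      finally show ?thesis by simp
    qed
    ultimately show "((\<lambda>v. \<bar>2 * v / (2 * w)\<^sup>2\<bar> * ?f (?g v)) has_integral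
         2 * Gamma (2 * a) / (2 * w) powr (2 * a)) {0<..}"
      by (subst has_integral_cong[where g = "\<lambda>v. 2 / (2 * w) powr (2 * a) * (v powr (2 * a - 1) * exp (- v))"]) auto
  qed (auto simp: sets_completionI_sets)
  then show ?thesis unfolding img .
qed

text \<open>Supplies the dominating function for termwise integration below, where half of the decay
  of exp(-s) is spent on absorbing the factor exp(2 |w| sqrt s).\<close>

lemma Gamma_integrand_exp_half_integrable:
  fixes a :: real
  assumes "a > 0"
  shows "(\<lambda>s. s powr (a - 1) * exp (- (s / 2))) integrable_on {0<..}"
proof -
  have img: "(\<lambda>v::real. 2 * v) ` {0<..} = {0<..}"
    by (auto simp: image_iff intro!: bexI[of _ "_ / 2"])
  have "((\<lambda>s. s powr (a - 1) * exp (- (s / 2))) has_integral 2 powr a * Gamma a)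
          ((\<lambda>v. 2 * v) ` {0<..})"
  proof (rule has_integral_change_of_variables_nonneg[where g' = "\<lambda>_. 2"])
    have "((\<lambda>v. 2 powr a * (v powr (a - 1) * exp (- v))) has_integral 2 powr a * Gamma a) {0<..}"
      using assms by (intro has_integral_mult_right Gamma_integral_open) simp
    moreover have "2 powr a * (v powr (a - 1) * exp (- v)) =
        \<bar>2\<bar> * ((2 * v) powr (a - 1) * exp (- (2 * v / 2)))" if "v \<in> {0<..}" for v :: real
      using that powr_add[of 2 "a - 1" 1] by (simp add: powr_mult)
    ultimately show "((\<lambda>v. \<bar>2\<bar> * ((2 * v) powr (a - 1) * exp (- (2 * v / 2)))) has_integral
        2 powr a * Gamma a) {0<..}"
      by (rule has_integral_eq[rotated])
  qed (auto intro!: derivative_eq_intros inj_onI)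
  then show ?thesis unfolding img by blast
qed


section \<open>The inner integral: power series, link to erfc, two-sided bounds\<close>

text \<open>For a > 0 this is, up to elementary factors and \<open>Gamma (2 * a)\<close>, the
  parabolic cylinder function of order -2a at sqrt 2 * w, as s = u^2 shows. In the variable s the
  power series in w integrates termwise to Gamma values.\<close>

definition sqrt_Laplace :: "real \<Rightarrow> real \<Rightarrow> real" where
  "sqrt_Laplace a w = integral {0<..} (\<lambda>s. s powr (a - 1) * exp (- s - 2 * w * sqrt s))"

text \<open>Expand exp(-2 w sqrt s) as a power series and integrate term by term: the k-th term
  contributes s^(k/2), which shifts the Gamma argument by k/2. Dominated convergence justifies the
  exchange for w of either sign, and negative arguments do occur later.\<close>

lemma
  fixes a w :: real
  assumes a: "a > 0"
  shows sqrt_Laplace_has_integral: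
      "((\<lambda>s. s powr (a - 1) * exp (- s - 2 * w * sqrt s)) has_integral sqrt_Laplace a w) {0<..}"
    and sqrt_Laplace_sums:
      "(\<lambda>k. (- (2 * w)) ^ k / fact k * Gamma (real k / 2 + a)) sums sqrt_Laplace a w"
proof -
  let ?c = "\<lambda>k. (- (2 * w)) ^ k / fact k :: real"
  let ?f = "\<lambda>N s. \<Sum>k<N. ?c k * (s powr (real k / 2 + a - 1) * exp (- s))"
  let ?g = "\<lambda>s. s powr (a - 1) * exp (- s - 2 * w * sqrt s)"
  let ?h = "\<lambda>s. exp (2 * w\<^sup>2) * (s powr (a - 1) * exp (- (s / 2)))"
  have f_int: "(?f N has_integral (\<Sum>k<N. ?c k * Gamma (real k / 2 + a))) {0<..}" for N
    using a by (intro has_integral_sum has_integral_mult_right Gamma_integral_open) auto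
  have h_int: "?h integrable_on {0<..}"
    using a by (intro integrable_on_mult_right Gamma_integrand_exp_half_integrable)
  have f_eq: "?f N s = s powr (a - 1) * exp (- s) * (\<Sum>k<N. (- 2 * w * sqrt s) ^ k / fact k)"
    if s: "s > 0" for N s
  proof -
    have "s powr (real k / 2 + a - 1) = s powr (a - 1) * sqrt s ^ k" for k
    proof -
      have "sqrt s ^ k = s powr (real k / 2)"
        using s powr_realpow[of "sqrt s" k] powr_powr[of s "1/2" "real k"]
        by (simp add: powr_half_sqrt)
      then show ?thesis
        by (simp add: powr_add[symmetric] algebra_simps)
    qed
    moreover have "(- 2 * w * sqrt s) ^ k = (- (2 * w)) ^ k * sqrt s ^ k" for k
      by (simp flip: power_mult_distrib)
    ultimately show ?thesis
      by (simp add: sum_distrib_left mult_ac)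
  qed
  have bound: "norm (?f N s) \<le> ?h s" if "s \<in> {0<..}" for N s
  proof -
    have s: "s > 0" using that by simp
    have "\<bar>\<Sum>k<N. (- 2 * w * sqrt s) ^ k / fact k\<bar> \<le> (\<Sum>k<N. (2 * \<bar>w\<bar> * sqrt s) ^ k / fact k)"
      using s by (intro order_trans[OF sum_abs] sum_mono) (simp add: power_abs abs_mult)
    also have "\<dots> \<le> exp (2 * \<bar>w\<bar> * sqrt s)"
      using s exp_converges[of "2 * \<bar>w\<bar> * sqrt s"]
      by (intro sum_le_suminf[of _ "{..<N}", THEN order_trans])
         (auto simp: sums_iff divide_inverse mult.commute)
    \<comment> \<open>This is (sqrt s - 2 |w|)^2 >= 0 expanded and halved; it explains both the
      exp(-s/2) and the constant exp(2 w^2) in \<open>?h\<close>.\<close>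
    also have "2 * \<bar>w\<bar> * sqrt s \<le> s / 2 + 2 * w\<^sup>2"
      using sum_squares_ge_zero[of "sqrt s - 2 * \<bar>w\<bar>" 0] s
      by (simp add: algebra_simps power2_eq_square)
    finally have "\<bar>\<Sum>k<N. (- 2 * w * sqrt s) ^ k / fact k\<bar> \<le> exp (s / 2 + 2 * w\<^sup>2)"
      by simp
    then have "norm (?f N s) \<le> s powr (a - 1) * exp (- s) * exp (s / 2 + 2 * w\<^sup>2)"
      unfolding f_eq[OF s] by (simp add: abs_mult mult_left_mono)
    also have "\<dots> = ?h s"
      by (simp add: exp_add[symmetric] mult_ac)
    finally show ?thesis .
  qed
  have lim: "(\<lambda>N. ?f N s) \<longlonglongrightarrow> ?g s" if "s \<in> {0<..}" for s
  proof -
    have s: "s > 0" using that by simp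
    have "(\<lambda>N. s powr (a - 1) * exp (- s) * (\<Sum>k<N. (- 2 * w * sqrt s) ^ k / fact k))
        \<longlonglongrightarrow> s powr (a - 1) * exp (- s) * exp (- 2 * w * sqrt s)"
      using exp_converges[of "- 2 * w * sqrt s"]
      by (intro tendsto_mult_left) (simp add: sums_def divide_inverse mult.commute)
    then show ?thesis
      unfolding f_eq[OF s] by (simp add: mult.assoc exp_add[symmetric])
  qed
  note dom = dominated_convergence[of ?f "{0<..}" ?h ?g,
      OF has_integral_integrable[OF f_int] h_int bound lim]
  show "(?g has_integral sqrt_Laplace a w) {0<..}"
    unfolding sqrt_Laplace_def using dom(1) by (rule integrable_integral)
  show "(\<lambda>k. ?c k * Gamma (real k / 2 + a)) sums sqrt_Laplace a w"
    using dom(2) unfolding integral_unique[OF f_int] sums_def sqrt_Laplace_def .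
qed

text \<open>Complete the square, s + 2 w sqrt s = (sqrt s + w)^2 - w^2, and substitute t = sqrt s +
  w, whose Jacobian is half of s^(-1/2).\<close>

lemma sqrt_Laplace_half: "sqrt_Laplace (1/2) w = sqrt pi * exp (w\<^sup>2) * erfc w"
proof -
  let ?g = "\<lambda>s. sqrt s + w"
  have img: "?g ` {0<..} = {w<..}"
  proof (intro equalityI subsetI)
    fix t assume "t \<in> {w<..}"
    then have "t = ?g ((t - w)\<^sup>2)" "(t - w)\<^sup>2 \<in> {0<..}" by auto
    then show "t \<in> ?g ` {0<..}" by blast
  qed auto
  have "((\<lambda>t. exp (- t\<^sup>2)) has_integral exp (- w\<^sup>2) / 2 * sqrt_Laplace (1/2) w) (?g ` {0<..})"
  proof (rule has_integral_change_of_variables_nonneg[where g' = "\<lambda>s. inverse (sqrt s) / 2"])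
    show "(?g has_field_derivative inverse (sqrt s) / 2) (at s within {0<..})" if "s \<in> {0<..}" for s
      using that by (auto intro!: derivative_eq_intros)
    have "((\<lambda>s. exp (- w\<^sup>2) / 2 * (s powr (1/2 - 1) * exp (- s - 2 * w * sqrt s))) has_integral
             exp (- w\<^sup>2) / 2 * sqrt_Laplace (1/2) w) {0<..}"
      by (intro has_integral_mult_right sqrt_Laplace_has_integral) simp
    moreover have "exp (- w\<^sup>2) / 2 * (s powr (1/2 - 1) * exp (- s - 2 * w * sqrt s))
        = \<bar>inverse (sqrt s) / 2\<bar> * exp (- (sqrt s + w)\<^sup>2)" if "s \<in> {0<..}" for s
    proof -
      have "s powr (1/2 - 1) = inverse (sqrt s)"
        using that powr_minus[of s "1/2"] by (simp add: powr_half_sqrt)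
      moreover have "exp (- w\<^sup>2) * exp (- s - 2 * w * sqrt s) = exp (- (sqrt s + w)\<^sup>2)"
        using that by (simp add: exp_add[symmetric] power2_sum algebra_simps)
      ultimately show ?thesis using that by (simp add: field_simps)
    qed
    ultimately show "((\<lambda>s. \<bar>inverse (sqrt s) / 2\<bar> * exp (- (sqrt s + w)\<^sup>2)) has_integral
        exp (- w\<^sup>2) / 2 * sqrt_Laplace (1/2) w) {0<..}"
      by (rule has_integral_eq[rotated])
  qed (auto intro!: inj_onI)
  then have "integral {w..} (\<lambda>t. exp (- t\<^sup>2)) = exp (- w\<^sup>2) / 2 * sqrt_Laplace (1/2) w"
    unfolding img has_integral_greaterThan_iff_atLeast by (rule integral_unique)
  then show ?thesis
    by (simp add: erfc_def exp_minus field_simps)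
qed

lemma Gamma_legendre_duplication_real:
  fixes x :: real
  assumes "x > 0"
  shows "Gamma x * Gamma (x + 1/2) = 2 powr (1 - 2 * x) * sqrt pi * Gamma (2 * x)"
proof -
  have "complex_of_real x \<notin> \<int>\<^sub>\<le>\<^sub>0" "complex_of_real x + 1/2 \<notin> \<int>\<^sub>\<le>\<^sub>0"
    using assms by (auto elim!: nonpos_Ints_cases' simp: complex_eq_iff)
  from Gamma_legendre_duplication[OF this]
  have "complex_of_real (Gamma x * Gamma (x + 1/2)) =
      of_real (exp ((1 - 2 * x) * ln 2) * sqrt pi * Gamma (2 * x))"
    by (simp flip: Gamma_complex_of_real exp_of_real)
  then show ?thesis
    unfolding of_real_eq_iff by (simp add: powr_def)
qed

text \<open>Duplication at k/2 + 1/2. It converts the \<open>fact k\<close> of the exponential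
  series into the denominators Gamma(k/2 + 1), which for even and odd k are the denominators in P
  and Q.\<close>

lemma Gamma_half_mult_Gamma_half_Suc:
  "Gamma (real k / 2 + 1/2) * Gamma (real k / 2 + 1) = sqrt pi * fact k / 2 ^ k"
proof -
  have "2 powr (1 - 2 * (real k / 2 + 1 / 2)) = 1 / 2 ^ k"
    by (simp add: powr_minus powr_realpow field_simps)
  moreover have "Gamma (2 * (real k / 2 + 1/2)) = fact k"
    using Gamma_fact[of k, where 'a = real] by (simp add: algebra_simps)
  ultimately show ?thesis
    using Gamma_legendre_duplication_real[of "real k / 2 + 1/2"] by (simp add: add.assoc)
qed

text \<open>Integrate 1 - s <= exp(-s) <= 1 against s^(a-1) exp(-2 w sqrt s). The subtracted term is
  the same integral with a + 1 for a, so its ratio to the leading one is 2a (2a + 1) /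
  (2w)^2.\<close>

lemma sqrt_Laplace_bounds:
  fixes a w :: real
  assumes a: "a > 0" and w: "w > 0"
  shows "sqrt_Laplace a w \<le> 2 * Gamma (2 * a) / (2 * w) powr (2 * a)"
    and "2 * Gamma (2 * a) / (2 * w) powr (2 * a) * (1 - a * (2 * a + 1) / (2 * w\<^sup>2)) \<le> sqrt_Laplace a w"
proof -
  note I0 = Gamma_integral_sqrt[OF a w]
  have I1: "((\<lambda>s. s powr (a + 1 - 1) * exp (- (2 * w * sqrt s))) has_integral
           2 * Gamma (2 * (a + 1)) / (2 * w) powr (2 * (a + 1))) {0<..}"
    using a w by (intro Gamma_integral_sqrt) auto
  show "sqrt_Laplace a w \<le> 2 * Gamma (2 * a) / (2 * w) powr (2 * a)"
    using sqrt_Laplace_has_integral[OF a] I0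
    by (rule has_integral_le) (auto intro!: mult_left_mono)
  have "2 * Gamma (2 * a) / (2 * w) powr (2 * a) - 2 * Gamma (2 * (a + 1)) / (2 * w) powr (2 * (a + 1))
      \<le> sqrt_Laplace a w"
    using has_integral_diff[OF I0 I1] sqrt_Laplace_has_integral[OF a]
  proof (rule has_integral_le)
    fix s :: real assume s: "s \<in> {0<..}"
    have "s powr (a - 1) * exp (- (2 * w * sqrt s)) - s powr (a + 1 - 1) * exp (- (2 * w * sqrt s))
        = s powr (a - 1) * exp (- (2 * w * sqrt s)) * (1 - s)"
      using s powr_add[of s "a - 1" 1] by (simp add: algebra_simps)
    also have "\<dots> \<le> s powr (a - 1) * exp (- (2 * w * sqrt s)) * exp (- s)"
      using exp_ge_add_one_self[of "- s"] by (intro mult_left_mono) auto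
    also have "\<dots> = s powr (a - 1) * exp (- s - 2 * w * sqrt s)"
      by (simp add: mult.assoc exp_add[symmetric])
    finally show "s powr (a - 1) * exp (- (2 * w * sqrt s)) - s powr (a + 1 - 1) * exp (- (2 * w * sqrt s))
       \<le> s powr (a - 1) * exp (- s - 2 * w * sqrt s)" .
  qed
  moreover have "Gamma (2 * (a + 1)) = (2 * a + 1) * (2 * a) * Gamma (2 * a)"
  proof -
    have "2 * a \<notin> \<int>\<^sub>\<le>\<^sub>0" "2 * a + 1 \<notin> \<int>\<^sub>\<le>\<^sub>0"
      using a by (auto elim!: nonpos_Ints_cases)
    then show ?thesis
      using Gamma_plus1[of "2 * a"] Gamma_plus1[of "2 * a + 1"] by (simp add: algebra_simps)
  qed
  moreover have "(2 * w) powr (2 * (a + 1)) = (2 * w) powr (2 * a) * (4 * w\<^sup>2)"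
    using w powr_add[of "2 * w" "2 * a" 2] by (simp add: algebra_simps power2_eq_square)
  moreover have "2 * Gamma (2 * a) / (2 * w) powr (2 * a) -
        2 * ((2 * a + 1) * (2 * a) * Gamma (2 * a)) / ((2 * w) powr (2 * a) * (4 * w\<^sup>2))
      = 2 * Gamma (2 * a) / (2 * w) powr (2 * a) * (1 - a * (2 * a + 1) / (2 * w\<^sup>2))"
    using w by (simp add: field_simps)
  ultimately show "2 * Gamma (2 * a) / (2 * w) powr (2 * a) * (1 - a * (2 * a + 1) / (2 * w\<^sup>2)) \<le> sqrt_Laplace a w"
    by simp
qed


section \<open>Complementary incomplete beta functions and resummation of F - 2 P\<close>

lemma
  fixes y a b :: real
  assumes y: "0 \<le> y" "y \<le> 1" and ab: "a > 0" "b > 0"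
  shows one_minus_inc_beta:
      "1 - inc_beta y a b = integral {y..1} (\<lambda>t. t powr (a - 1) * (1 - t) powr (b - 1)) / Beta a b"
    and inc_beta_nonneg: "0 \<le> inc_beta y a b"
    and inc_beta_le_1: "inc_beta y a b \<le> 1"
proof -
  let ?f = "\<lambda>t. t powr (a - 1) * (1 - t) powr (b - 1)"
  have Beta_pos: "Beta a b > 0"
    using ab by (simp add: Beta_def)
  have "integral {0..y} ?f + integral {y..1} ?f = Beta a b"
    using Henstock_Kurzweil_Integration.integral_combine[OF y integrable_Beta'[OF ab]]
      integral_unique[OF has_integral_Beta_real[OF ab]] by simp
  then have "Beta a b * inc_beta y a b + integral {y..1} ?f = Beta a b"
    using Beta_pos by (simp add: inc_beta_def)
  then show eq: "1 - inc_beta y a b = integral {y..1} ?f / Beta a b"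
    using Beta_pos by (simp add: field_simps)
  have "?f integrable_on {0..y}" "?f integrable_on {y..1}"
    using y by (auto intro!: integrable_subinterval_real[OF integrable_Beta'[OF ab]])
  then have "integral {0..y} ?f \<ge> 0" "integral {y..1} ?f \<ge> 0"
    by (auto intro!: Henstock_Kurzweil_Integration.integral_nonneg)
  then have "0 \<le> 1 / Beta a b * integral {0..y} ?f" "0 \<le> 1 - inc_beta y a b"
    unfolding eq using Beta_pos by (auto intro!: mult_nonneg_nonneg divide_nonneg_pos)
  then show "0 \<le> inc_beta y a b" "inc_beta y a b \<le> 1"
    by (auto simp only: inc_beta_def)
qed

text \<open>Insert the series of \<open>sqrt_Laplace\<close> at w sqrt t: each power sqrt t ^ k
  times t^(-1/2) is a beta integrand with first parameter k/2 + 1/2, so integration over {y..1}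
  yields 1 - I_y. The coefficient Gamma(k/2 + 1/2 + b) cancels against the beta normalization, and
  the duplication formula removes \<open>fact k\<close>.\<close>

lemma
  fixes b w y :: real
  assumes b: "b > 0" and w: "w \<ge> 0" and y: "0 < y" "y < 1"
  defines "g \<equiv> \<lambda>t. t powr (- 1/2) * (1 - t) powr (b - 1) * sqrt_Laplace (b + 1/2) (w * sqrt t)"
  shows sqrt_Laplace_beta_integrable: "g integrable_on {y..1}"
    and complementary_inc_beta_sums:
      "(\<lambda>k. (- w) ^ k / Gamma (real k / 2 + 1) * (1 - inc_beta y (real k / 2 + 1/2) b)) sums
        (integral {y..1} g / (sqrt pi * Gamma b))"
proof -
  define h where "h = (\<lambda>t. t powr (- 1/2) * (1 - t) powr (b - 1))"
  \<comment> \<open>The argument is kept as a parameter because the coefficients are needed at w, at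
    w sqrt t and at -w.\<close>
  define c where "c = (\<lambda>w k. (- (2 * w)) ^ k / fact k * Gamma (real k / 2 + (b + 1/2)))"
  define f where "f = (\<lambda>N t. \<Sum>k<N. c w k * (t powr (real k / 2 + 1/2 - 1) * (1 - t) powr (b - 1)))"
  have term_int: "(\<lambda>t. t powr (real k / 2 + 1/2 - 1) * (1 - t) powr (b - 1)) integrable_on {y..1}" for k
    using y b by (intro integrable_subinterval_real[OF integrable_Beta'[of "real k / 2 + 1/2" b]]) auto
  have h_int: "h integrable_on {y..1}"
    using term_int[of 0] by (simp add: h_def)
  have f_int: "f N integrable_on {y..1}" for N
    unfolding f_def by (intro integrable_sum integrable_on_mult_right term_int) auto
  have c_sums: "c v sums sqrt_Laplace (b + 1/2) v" for v
    unfolding c_def using b by (intro sqrt_Laplace_sums) simp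
  have f_eq: "f N t = h t * (\<Sum>k<N. c (w * sqrt t) k)" if t: "t > 0" for N t
  proof -
    have "t powr (real k / 2 + 1/2 - 1) = t powr (- 1/2) * sqrt t ^ k" for k
    proof -
      have "sqrt t ^ k = t powr (real k / 2)"
        using t powr_realpow[of "sqrt t" k] powr_powr[of t "1/2" "real k"]
        by (simp add: powr_half_sqrt)
      then show ?thesis
        by (simp add: powr_add[symmetric] algebra_simps)
    qed
    moreover have "(- (2 * (w * sqrt t))) ^ k = (- (2 * w)) ^ k * sqrt t ^ k" for k
      by (simp add: mult.assoc flip: power_mult_distrib)
    ultimately show ?thesis
      by (simp add: f_def h_def c_def sum_distrib_left mult_ac)
  qed
  \<comment> \<open>At the argument -w every term of the series is nonnegative and, since t <= 1,
    dominates the absolute value of the term at w sqrt t. Its sum therefore bounds all partial sums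
    uniformly in t.\<close>
  have bound: "norm (f N t) \<le> sqrt_Laplace (b + 1/2) (- w) * h t" if "t \<in> {y..1}" for N t
  proof -
    have t: "0 < t" "t \<le> 1" using that y by auto
    have c_bound: "\<bar>c (w * sqrt t) k\<bar> \<le> c (- w) k" for k
    proof -
      have "Gamma (real k / 2 + (b + 1/2)) > 0" using b by (intro Gamma_real_pos) auto
      moreover have "\<bar>- (2 * (w * sqrt t))\<bar> ^ k \<le> (2 * w) ^ k"
        using t w by (intro power_mono) (auto simp: abs_mult mult_left_le)
      ultimately show ?thesis
        by (simp add: c_def abs_mult power_abs divide_right_mono mult_right_mono)
    qed
    have "\<bar>\<Sum>k<N. c (w * sqrt t) k\<bar> \<le> (\<Sum>k<N. c (- w) k)"
      by (intro order_trans[OF sum_abs] sum_mono c_bound)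
    also have "\<dots> \<le> sqrt_Laplace (b + 1/2) (- w)"
      using c_sums[of "- w"] abs_ge_zero[THEN order_trans, OF c_bound]
      by (intro sum_le_suminf[of _ "{..<N}", THEN order_trans]) (auto simp: sums_iff)
    finally have "\<bar>\<Sum>k<N. c (w * sqrt t) k\<bar> \<le> sqrt_Laplace (b + 1/2) (- w)" .
    moreover have "h t \<ge> 0" by (simp add: h_def)
    ultimately show ?thesis
      unfolding f_eq[OF t(1)] by (simp add: abs_mult mult_left_mono mult.commute)
  qed
  have lim: "(\<lambda>N. f N t) \<longlonglongrightarrow> g t" if "t \<in> {y..1}" for t
  proof -
    have t: "t > 0" using that y by auto
    have g_eq: "g t = h t * sqrt_Laplace (b + 1/2) (w * sqrt t)"
      by (simp add: g_def h_def)
    show ?thesis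
      unfolding f_eq[OF t] g_eq
      using c_sums[of "w * sqrt t"] by (intro tendsto_mult_left) (simp add: sums_def)
  qed
  note dom = dominated_convergence[OF f_int integrable_on_mult_right[OF h_int] bound lim]
  show "g integrable_on {y..1}" by (rule dom(1))
  let ?J = "\<lambda>k. integral {y..1} (\<lambda>t. t powr (real k / 2 + 1/2 - 1) * (1 - t) powr (b - 1))"
  have "integral {y..1} (f N) = (\<Sum>k<N. c w k * ?J k)" for N
    unfolding f_def using integrable_on_mult_right[OF term_int]
    by (subst integral_sum) (auto simp del: integrable_on_cmult_left_iff)
  then have "(\<lambda>k. c w k * ?J k) sums integral {y..1} g"
    using dom(2) by (simp add: sums_def)
  then have "(\<lambda>k. c w k * ?J k / (sqrt pi * Gamma b)) sums (integral {y..1} g / (sqrt pi * Gamma b))"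
    by (rule sums_divide)
  moreover have "c w k * ?J k / (sqrt pi * Gamma b) =
      (- w) ^ k / Gamma (real k / 2 + 1) * (1 - inc_beta y (real k / 2 + 1/2) b)" for k
  proof -
    have pos: "Gamma (real k / 2 + 1/2) > 0" "Gamma (real k / 2 + 1) > 0" "Gamma b > 0"
      "Gamma (real k / 2 + 1/2 + b) > 0"
      using b by (auto intro!: Gamma_real_pos)
    have "(- w) ^ k / Gamma (real k / 2 + 1) * (1 - inc_beta y (real k / 2 + 1/2) b) =
       (- w) ^ k * Gamma (real k / 2 + 1/2 + b) * ?J k /
         ((Gamma (real k / 2 + 1/2) * Gamma (real k / 2 + 1)) * Gamma b)"
      using y b pos by (subst one_minus_inc_beta) (auto simp: Beta_def mult_ac)
    also have "\<dots> = (- w) ^ k * 2 ^ k * Gamma (real k / 2 + 1/2 + b) * ?J k /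
         (sqrt pi * fact k * Gamma b)"
      unfolding Gamma_half_mult_Gamma_half_Suc by simp
    also have "(- w) ^ k * 2 ^ k = (- (2 * w)) ^ k"
      by (simp add: mult.commute flip: power_mult_distrib)
    finally show ?thesis
      by (simp add: c_def add_ac mult_ac)
  qed
  ultimately show "(\<lambda>k. (- w) ^ k / Gamma (real k / 2 + 1) * (1 - inc_beta y (real k / 2 + 1/2) b)) sums
        (integral {y..1} g / (sqrt pi * Gamma b))"
    by simp
qed

text \<open>The case a = 1/2 of the series for \<open>sqrt_Laplace\<close>, rewritten by
  duplication. Subtracting the complementary series from it leaves the factors I_y
  themselves.\<close>

lemma erfc_sums: "(\<lambda>k. (- w) ^ k / Gamma (real k / 2 + 1)) sums (exp (w\<^sup>2) * erfc w)"
proof -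
  have "(\<lambda>k. (- (2 * w)) ^ k / fact k * Gamma (real k / 2 + 1/2) / sqrt pi) sums
      (sqrt_Laplace (1/2) w / sqrt pi)"
    by (intro sums_divide sqrt_Laplace_sums) simp
  moreover have "(- (2 * w)) ^ k / fact k * Gamma (real k / 2 + 1/2) / sqrt pi =
      (- w) ^ k / Gamma (real k / 2 + 1)" for k
  proof -
    have pos: "Gamma (real k / 2 + 1/2) > 0" "Gamma (real k / 2 + 1) > 0"
      by (auto intro!: Gamma_real_pos)
    have "(- (2 * w)) ^ k = (- w) ^ k * 2 ^ k"
      by (simp add: mult.commute flip: power_mult_distrib)
    moreover have "Gamma (real k / 2 + 1/2) = sqrt pi * fact k / 2 ^ k / Gamma (real k / 2 + 1)"
      using pos Gamma_half_mult_Gamma_half_Suc[of k] by (simp only: eq_divide_eq) auto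
    ultimately show ?thesis
      by simp
  qed
  ultimately show ?thesis
    by (simp add: sqrt_Laplace_half)
qed

text \<open>F - 2 P equals erfc / 2 - (P - Q). The series with factors I_y has the terms of P at
  even k and minus those of Q at odd k, so P - Q is half of erfc minus the resummed integral, and
  erfc cancels.\<close>

lemma nct_F_minus_2_nct_P:
  fixes n x \<delta> :: real
  defines "y \<equiv> nct_y n x"
  assumes n: "n > 0" and \<delta>: "\<delta> \<ge> 0" and y: "0 < y" "y < 1"
  shows "nct_F n x \<delta> - 2 * nct_P n x \<delta> =
    exp (- (\<delta>\<^sup>2 / 2)) / (2 * sqrt pi * Gamma (n / 2)) *
      integral {y..1} (\<lambda>t. t powr (- 1/2) * (1 - t) powr (n / 2 - 1) *
        sqrt_Laplace (n / 2 + 1/2) (\<delta> / sqrt 2 * sqrt t))"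
proof -
  define w where "w = \<delta> / sqrt 2"
  have w: "w \<ge> 0" "w\<^sup>2 = \<delta>\<^sup>2 / 2" using \<delta> by (auto simp: w_def power_divide)
  define X where "X = integral {y..1} (\<lambda>t. t powr (- 1/2) * (1 - t) powr (n / 2 - 1) *
        sqrt_Laplace (n / 2 + 1/2) (w * sqrt t)) / (sqrt pi * Gamma (n / 2))"
  define a where "a = (\<lambda>k. (- w) ^ k / Gamma (real k / 2 + 1) * inc_beta y (real k / 2 + 1/2) (n / 2))"
  define p where "p = (\<lambda>j. (\<delta>\<^sup>2 / 2) ^ j / fact j * inc_beta y (real j + 1/2) (n / 2))"
  define q where "q = (\<lambda>j. \<delta> / sqrt 2 * ((\<delta>\<^sup>2 / 2) ^ j / Gamma (real j + 3/2)) *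
        inc_beta y (real j + 1) (n / 2))"
  have "a sums (exp (w\<^sup>2) * erfc w - X)"
    using sums_diff[OF erfc_sums[of w] complementary_inc_beta_sums[of "n / 2" w y]] n w(1) y
    unfolding X_def a_def by (simp add: algebra_simps)
  \<comment> \<open>Bracketing consecutive pairs preserves the sum of a convergent series, so
    absolute convergence does not enter.\<close>
  then have "(\<lambda>j. sum a {j * 2..<j * 2 + 2}) sums (exp (w\<^sup>2) * erfc w - X)"
    by (rule sums_group) simp
  moreover have "sum a {j * 2..<j * 2 + 2} = p j - q j" for j
  proof -
    have "sum a {j * 2..<j * 2 + 2} = a (2 * j) + a (2 * j + 1)"
      by (simp add: mult.commute numeral_2_eq_2)
    moreover have "a (2 * j) = p j"
      using Gamma_fact[of j, where 'a = real]
      by (simp add: a_def p_def power_mult w(2) add.commute)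
    moreover have "a (2 * j + 1) = - q j"
    proof -
      have "real (2 * j + 1) / 2 + 1 = real j + 3/2" "real (2 * j + 1) / 2 + 1/2 = real j + 1"
        by (simp_all add: field_simps)
      moreover have "(- w) ^ (2 * j + 1) = - (w * (\<delta>\<^sup>2 / 2) ^ j)"
        by (simp add: power_mult w(2))
      ultimately show ?thesis
        by (simp only: a_def q_def w_def[symmetric]) simp
    qed
    ultimately show ?thesis by simp
  qed
  ultimately have pq: "(\<lambda>j. p j - q j) sums (exp (w\<^sup>2) * erfc w - X)" by simp
  have p_summable: "summable p"
  proof (rule summable_comparison_test')
    show "summable (\<lambda>j. (\<delta>\<^sup>2 / 2) ^ j / fact j)"
      using summable_exp[of "\<delta>\<^sup>2 / 2"] by (simp only: divide_inverse[of "_ ^ _"] mult.commute)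
    show "norm (p j) \<le> (\<delta>\<^sup>2 / 2) ^ j / fact j" for j
      using inc_beta_nonneg[of y "real j + 1/2" "n / 2"] inc_beta_le_1[of y "real j + 1/2" "n / 2"] n y
      by (simp add: p_def abs_mult mult_left_le divide_right_mono)
  qed
  \<comment> \<open>Since q = p - (p - q), summability follows without estimating Gamma(j +
    3/2).\<close>
  then have q_summable: "summable q"
    using summable_diff[OF p_summable sums_summable[OF pq]] by simp
  have diff: "exp (w\<^sup>2) * erfc w - X = suminf p - suminf q"
    using suminf_diff[OF p_summable q_summable] pq by (simp add: sums_iff)
  have "nct_P n x \<delta> = 1/2 * exp (- (\<delta>\<^sup>2 / 2)) * suminf p"
    "nct_Q n x \<delta> = 1/2 * exp (- (\<delta>\<^sup>2 / 2)) * suminf q"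
    by (simp_all add: nct_P_def nct_Q_def p_def q_def y_def)
  then have "nct_F n x \<delta> - 2 * nct_P n x \<delta> =
      1/2 * erfc w - 1/2 * exp (- (\<delta>\<^sup>2 / 2)) * (exp (w\<^sup>2) * erfc w - X)"
    unfolding diff by (simp add: nct_F_def w_def algebra_simps diff_divide_distrib)
  also have "\<dots> = 1/2 * exp (- (\<delta>\<^sup>2 / 2)) * X"
    by (simp add: w(2) exp_minus algebra_simps diff_divide_distrib)
  finally show ?thesis
    by (simp add: X_def w_def)
qed

section \<open>Bounds for the integral over t\<close>

text \<open>The integrand is the derivative of -((1 - t)/t)^b / b, which vanishes at t = 1.\<close>

lemma has_integral_beta_kernel:
  fixes b y :: real
  assumes b: "b > 0" and y: "0 < y" "y < 1"
  shows "((\<lambda>t. t powr (- 1 - b) * (1 - t) powr (b - 1)) has_integral ((1 - y) / y) powr b / b) {y..1}"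
proof -
  let ?F = "\<lambda>t. - (((1 - t) / t) powr b / b)"
  have "((\<lambda>t. t powr (- 1 - b) * (1 - t) powr (b - 1)) has_integral ?F 1 - ?F y) {y..1}"
  \<comment> \<open>For b < 1 the integrand is unbounded near t = 1; the interior form asks only for
    continuity of the antiderivative at the endpoints.\<close>
  proof (rule fundamental_theorem_of_calculus_interior)
    show "continuous_on {y..1} ?F"
      using b y by (intro continuous_intros continuous_on_powr') auto
    fix t assume "t \<in> {y<..<1}"
    then have t: "0 < t" "t < 1" using y by auto
    have "((\<lambda>t. (1 - t) / t) has_real_derivative - 1 / t\<^sup>2) (at t)"
      using t by (auto intro!: derivative_eq_intros simp: power2_eq_square field_simps)
    then have "((\<lambda>t. ((1 - t) / t) powr b) has_real_derivative
        b * ((1 - t) / t) powr (b - 1) * (- 1 / t\<^sup>2)) (at t)"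
      using t DERIV_fun_powr[where r = b and x = t and g = "\<lambda>t. (1 - t) / t" and m = "- 1 / t\<^sup>2"]
      by simp
    then have "(?F has_real_derivative - (b * ((1 - t) / t) powr (b - 1) * (- 1 / t\<^sup>2) / b)) (at t)"
      by (intro DERIV_minus DERIV_cdivide)
    also have "- (b * ((1 - t) / t) powr (b - 1) * (- 1 / t\<^sup>2) / b) =
        t powr (- 1 - b) * (1 - t) powr (b - 1)"
    proof -
      have "t powr (- 1 - b) = 1 / (t powr (b - 1) * t\<^sup>2)"
        using t powr_add[of t "b - 1" 2] powr_minus[of t "1 + b"] by (simp add: field_simps)
      then show ?thesis
        using t b by (simp add: powr_divide)
    qed
    finally show "(?F has_vector_derivative t powr (- 1 - b) * (1 - t) powr (b - 1)) (at t)"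
      by (simp add: has_real_derivative_iff_has_vector_derivative)
  qed (use y in auto)
  then show ?thesis by simp
qed

text \<open>With a = b + 1/2 the leading term of the inner integral at w sqrt t is a constant times
  t^(-b - 1/2). Together with the weight t^(-1/2) it gives exactly the kernel t^(-1 - b) (1 - t)^(b
  - 1) integrated above.\<close>

lemma sqrt_Laplace_beta_bounds:
  fixes b w y :: real
  assumes b: "b > 0" and w: "w > 0" and y: "0 < y" "y < 1"
  defines "X \<equiv> integral {y..1} (\<lambda>t. t powr (- 1/2) * (1 - t) powr (b - 1) *
      sqrt_Laplace (b + 1/2) (w * sqrt t))"
  defines "A \<equiv> 2 * Gamma (2 * b + 1) / (2 * w) powr (2 * b + 1) * (((1 - y) / y) powr b / b)"
  shows "X \<le> A"
    and "A * (1 - (2 * b + 1) * (b + 1) / (2 * w\<^sup>2 * y)) \<le> X"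
proof -
  define M where "M = 2 * Gamma (2 * b + 1) / (2 * w) powr (2 * b + 1)"
  \<comment> \<open>The lower-bound factor at t = y, its smallest value on {y..1}. It may be
    negative, which is harmless because it only multiplies nonnegative quantities.\<close>
  define E where "E = 1 - (2 * b + 1) * (b + 1) / (2 * w\<^sup>2 * y)"
  let ?k = "\<lambda>t. t powr (- 1 - b) * (1 - t) powr (b - 1)"
  let ?g = "\<lambda>t. t powr (- 1/2) * (1 - t) powr (b - 1) * sqrt_Laplace (b + 1/2) (w * sqrt t)"
  have M: "M > 0" using b w by (auto simp: M_def intro!: divide_pos_pos Gamma_real_pos)
  have X: "(?g has_integral X) {y..1}"
    unfolding X_def using b w y by (intro integrable_integral sqrt_Laplace_beta_integrable) auto
  have K: "((\<lambda>t. c * ?k t) has_integral c * (((1 - y) / y) powr b / b)) {y..1}" for c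
    using b y by (intro has_integral_mult_right has_integral_beta_kernel)
  have A: "A = M * (((1 - y) / y) powr b / b)" by (simp add: A_def M_def)
  have bounds: "?g t \<le> M * ?k t \<and> M * E * ?k t \<le> ?g t" if "t \<in> {y..1}" for t
  proof -
    have t: "0 < t" "y \<le> t" using that y by auto
    have m: "2 * Gamma (2 * (b + 1/2)) / (2 * (w * sqrt t)) powr (2 * (b + 1/2)) = M * t powr (- b - 1/2)"
    proof -
      have "sqrt t powr (2 * b + 1) = t powr (b + 1/2)"
        using t powr_powr[of t "1/2" "2 * b + 1"] by (simp add: powr_half_sqrt algebra_simps)
      then have "(2 * (w * sqrt t)) powr (2 * b + 1) = (2 * w) powr (2 * b + 1) * t powr (b + 1/2)"
        using w t by (simp add: powr_mult)
      moreover have "t powr (- b - 1/2) = 1 / t powr (b + 1/2)"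
        using powr_minus_divide[of t "b + 1/2"] by simp
      moreover have "2 * (b + 1/2) = 2 * b + 1"
        by simp
      ultimately show ?thesis
        by (simp only: M_def) simp
    qed
    have "(b + 1/2) * (2 * (b + 1/2) + 1) / (2 * (w * sqrt t)\<^sup>2) = (2 * b + 1) * (b + 1) / (2 * w\<^sup>2 * t)"
      using t w by (simp add: power_mult_distrib field_simps)
    also have "\<dots> \<le> (2 * b + 1) * (b + 1) / (2 * w\<^sup>2 * y)"
      using t w y b by (intro divide_left_mono mult_left_mono mult_pos_pos) auto
    finally have E: "E \<le> 1 - (b + 1/2) * (2 * (b + 1/2) + 1) / (2 * (w * sqrt t)\<^sup>2)"
      by (simp add: E_def)
    have "b + 1/2 > 0" "w * sqrt t > 0" using b w t by auto
    note B = sqrt_Laplace_bounds[OF this, unfolded m]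
    have S: "sqrt_Laplace (b + 1/2) (w * sqrt t) \<le> M * t powr (- b - 1/2)"
      "M * t powr (- b - 1/2) * E \<le> sqrt_Laplace (b + 1/2) (w * sqrt t)"
      using B(1) order_trans[OF mult_left_mono[OF E] B(2)] M by auto
    have k: "?k t = t powr (- 1/2) * (1 - t) powr (b - 1) * t powr (- b - 1/2)"
      using t powr_add[of t "- 1/2" "- b - 1/2"] by (simp add: mult_ac)
    have nn: "0 \<le> t powr (- 1/2) * (1 - t) powr (b - 1)" by simp
    show ?thesis
      using mult_left_mono[OF S(1) nn] mult_left_mono[OF S(2) nn]
      unfolding k by (simp add: mult_ac)
  qed
  show "X \<le> A"
    unfolding A using X K by (rule has_integral_le) (use bounds in auto)
  have "M * E * (((1 - y) / y) powr b / b) \<le> X"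
    using K X by (rule has_integral_le) (use bounds in auto)
  then show "A * (1 - (2 * b + 1) * (b + 1) / (2 * w\<^sup>2 * y)) \<le> X"
    unfolding A E_def by (simp add: mult_ac)
qed


section \<open>Leading term and relative error as the noncentrality grows\<close>

theorem theorem4p1:
  fixes n x y :: real
  assumes "n > 0" and "x > 0" and "y \<in> {0<..<1}" and "y = x\<^sup>2 / (n + x\<^sup>2)"
  shows "\<exists>r :: real \<Rightarrow> real. r \<in> O[at_top](\<lambda>\<delta>. \<delta> powr (-2)) \<and>
    (\<forall>\<^sub>F \<delta> in at_top. let \<zeta> = 1/2 * \<delta>\<^sup>2 * y in
      nct_F n x \<delta> = 2 * nct_P n x \<delta> +
        exp (- (\<delta>\<^sup>2 / 2)) * sqrt y * (1 - y) powr (n / 2) / (2 * pi) *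
        (Gamma (n / 2 + 1/2) / \<zeta> powr (n / 2 + 1/2)) * (1 + r \<delta>))"
proof -
  define b where "b = n / 2"
  have b: "b > 0" using assms(1) by (simp add: b_def)
  have y: "0 < y" "y < 1" "nct_y n x = y" using assms by (auto simp: nct_y_def)
  define M where "M = (\<lambda>\<delta>. exp (- (\<delta>\<^sup>2 / 2)) * sqrt y * (1 - y) powr b / (2 * pi) *
        (Gamma (b + 1/2) / (1/2 * \<delta>\<^sup>2 * y) powr (b + 1/2)))"
  define D where "D = (\<lambda>\<delta>. nct_F n x \<delta> - 2 * nct_P n x \<delta>)"
  \<comment> \<open>The constant of the lower bound for the integral over t, rewritten with 2 w^2 =
    \<delta>^2.\<close>
  define C where "C = (2 * b + 1) * (b + 1) / y"
  have main: "M \<delta> > 0 \<and> D \<delta> \<le> M \<delta> \<and> M \<delta> * (1 - C / \<delta>\<^sup>2) \<le> D \<delta>" if \<delta>: "\<delta> > 0" for \<delta>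
  proof -
    define w where "w = \<delta> / sqrt 2"
    have w: "w > 0" "\<delta>\<^sup>2 = 2 * w\<^sup>2" using \<delta> by (auto simp: w_def power_divide)
    define X where "X = integral {y..1} (\<lambda>t. t powr (- 1/2) * (1 - t) powr (b - 1) *
        sqrt_Laplace (b + 1/2) (w * sqrt t))"
    define A where "A = 2 * Gamma (2 * b + 1) / (2 * w) powr (2 * b + 1) * (((1 - y) / y) powr b / b)"
    define c where "c = exp (- (\<delta>\<^sup>2 / 2)) / (2 * sqrt pi * Gamma b)"
    have c: "c > 0" using b by (simp add: c_def)
    have D: "D \<delta> = c * X"
      using nct_F_minus_2_nct_P[of n \<delta> x] assms(1) y \<delta> by (simp add: D_def X_def c_def b_def w_def)
    \<comment> \<open>Duplication at b + 1/2 splits Gamma(2b + 1) into Gamma(b + 1/2) and Gamma(b +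
      1) = b Gamma(b). The b cancels the 1/b of the kernel integral, Gamma(b) cancels in
      \<open>c\<close>, and the powers match because zeta = w^2 y.\<close>
    have M: "M \<delta> = c * A"
    proof -
      have pos: "Gamma b > 0" "w powr (2 * b + 1) > 0" using b w by auto
      have "b \<notin> \<int>\<^sub>\<le>\<^sub>0"
        using b by (auto elim!: nonpos_Ints_cases)
      then have "2 powr (- 2 * b) * sqrt pi * Gamma (2 * b + 1) = Gamma (b + 1/2) * (b * Gamma b)"
        using b Gamma_legendre_duplication_real[of "b + 1/2"] Gamma_plus1[of b]
        by (simp add: add.assoc)
      then have G: "Gamma (2 * b + 1) = 2 powr (2 * b) * (Gamma (b + 1/2) * (b * Gamma b)) / sqrt pi"
        by (simp add: powr_minus field_simps)
      have "A = 2 * Gamma (2 * b + 1) / (2 * 2 powr (2 * b) * w powr (2 * b + 1)) * (((1 - y) / y) powr b / b)"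
        using w powr_add[of 2 "2 * b" 1] by (simp add: A_def powr_mult mult.commute)
      also have "\<dots> = Gamma (b + 1/2) * Gamma b / (sqrt pi * w powr (2 * b + 1)) * ((1 - y) powr b / y powr b)"
        unfolding G using b y by (simp add: powr_divide)
      finally have "c * A = exp (- (\<delta>\<^sup>2 / 2)) * Gamma (b + 1/2) * (1 - y) powr b /
          (2 * (sqrt pi * sqrt pi) * w powr (2 * b + 1) * y powr b)"
        using pos by (simp add: c_def mult.assoc del: real_sqrt_mult_self)
      moreover have "(1/2 * \<delta>\<^sup>2 * y) powr (b + 1/2) = w powr (2 * b + 1) * (y powr b * sqrt y)"
      proof -
        have "(w\<^sup>2) powr (b + 1/2) = w powr (2 * b + 1)"
          using w by (simp add: powr_powr algebra_simps flip: powr_numeral)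
        moreover have "y powr (b + 1/2) = y powr b * sqrt y"
          using y by (simp add: powr_add powr_half_sqrt)
        ultimately show ?thesis
          using w y by (simp add: powr_mult)
      qed
      ultimately show ?thesis
        using y by (simp add: M_def mult_ac)
    qed
    have "A > 0"
      using b w y by (auto simp: A_def intro!: mult_pos_pos divide_pos_pos Gamma_real_pos)
    moreover have "X \<le> A" "A * (1 - C / \<delta>\<^sup>2) \<le> X"
      using sqrt_Laplace_beta_bounds[OF b w(1) y(1,2)]
      by (simp_all add: X_def A_def C_def w(2) mult_ac)
    ultimately show ?thesis
      using c mult_left_mono[of X A c] mult_left_mono[of "A * (1 - C / \<delta>\<^sup>2)" X c]
      by (simp add: D M mult.assoc)
  qed
  \<comment> \<open>The exact relative error, so the identity holds whenever \<open>M\<close> is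
    nonzero; the enclosure in \<open>main\<close> puts it between -C / \<delta>^2 and 0.\<close>
  define r where "r = (\<lambda>\<delta>. D \<delta> / M \<delta> - 1)"
  have "r \<in> O[at_top](\<lambda>\<delta>. \<delta> powr (-2))"
  proof (rule bigoI[of _ C], use eventually_gt_at_top[of 0] in eventually_elim)
    case (elim \<delta>)
    have "D \<delta> / M \<delta> \<le> 1" "1 - C / \<delta>\<^sup>2 \<le> D \<delta> / M \<delta>"
      using main[OF elim] by (simp_all add: field_simps)
    moreover have "\<delta> powr (-2) = 1 / \<delta>\<^sup>2"
      using elim powr_minus_divide[of \<delta> 2] by simp
    ultimately show ?case
      by (simp add: r_def)
  qed
  moreover have "\<forall>\<^sub>F \<delta> in at_top. nct_F n x \<delta> = 2 * nct_P n x \<delta> + M \<delta> * (1 + r \<delta>)"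
    using eventually_gt_at_top[of 0]
  proof eventually_elim
    case (elim \<delta>)
    then have "M \<delta> \<noteq> 0" using main[of \<delta>] by auto
    then show ?case by (simp add: r_def D_def)
  qed
  ultimately show ?thesis
    unfolding Let_def by (intro exI[of _ r]) (simp add: M_def b_def)
qed

end
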